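(* Let $n\ge 1$ and let $a_1<a_2<\cdots<a_n$ and $b_1<b_2<\cdots<b_n$ be real numbers with $a_1=b_1$ such that no two of the numbers $a_2,\ldots,a_n,b_2,\ldots,b_n$ are equal. Let $$\Pi=\{\pi \text{ a permutation of }\{1,\ldots,n\}:\ \pi(1)=1 \text{ and } a_i<b_{\pi(i)} \text{ for } 2\le i\le n\},$$ and assume that $\Pi$ is nonempty. For a permutation $\pi$ of $\{1,\ldots,n\}$ put $A(\pi)=\sum_{1\le i\le n}a_i b_{\pi(i)}$. Let $\tau\in\Pi$ be the permutation realized by the Last-Come-First-Served discipline. Then $$A(\tau)\le A(\pi)\quad\text{for every }\pi\in\Pi .$$
   Context: Interpretation: $a_i$ is the arrival time of customer $i$ in a busy period of a queue, $b_l$ is the time of the $l$-th beginning of service in that busy period, and $\pi(i)=l$ means that customer $i$ begins service at time $b_l$; $\Pi$ is the set of permutations that can be realized by a service discipline. The permutation $\tau$ realized by Last-Come-First-Served is defined by $\tau(1)=1$ and, recursively for $l=2,\ldots,n$, $$\tau^{-1}(l)=\max\{\,i\in\{2,\ldots,n\}:\ a_i<b_l \text{ and } i\notin\{\tau^{-1}(2),\ldots,\tau^{-1}(l-1)\}\,\},$$ i.e. at time $b_l$ the most recently arrived customer among those who have arrived and have not yet been served is selected. (When $\Pi$ is nonempty, the sets over which the maxima are taken are nonempty, and $\tau$ belongs to $\Pi$.) *)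

theory Defs
  imports Complex_Main "HOL-Combinatorics.Permutations"
begin

definition realizable :: "nat \<Rightarrow> (nat \<Rightarrow> real) \<Rightarrow> (nat \<Rightarrow> real) \<Rightarrow> (nat \<Rightarrow> nat) set" where
  "realizable n a b =
     {\<pi>. \<pi> permutes {1..n} \<and> \<pi> 1 = 1 \<and> (\<forall>i\<in>{2..n}. a i < b (\<pi> i))}"

definition assignment_sum :: "nat \<Rightarrow> (nat \<Rightarrow> real) \<Rightarrow> (nat \<Rightarrow> real) \<Rightarrow> (nat \<Rightarrow> nat) \<Rightarrow> real" where
  "assignment_sum n a b \<pi> = (\<Sum>i=1..n. a i * b (\<pi> i))"

text \<open>
  The customer selected at time \<open>b l\<close> under Last-Come-First-Served, that is, the inverse
  permutation at \<open>l\<close>. \<open>Max\<close> is unspecified on the empty set; this case does not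
  arise for \<open>l \<le> n\<close> when \<^const>\<open>realizable\<close> is nonempty.
\<close>
fun lcfs_customer :: "nat \<Rightarrow> (nat \<Rightarrow> real) \<Rightarrow> (nat \<Rightarrow> real) \<Rightarrow> nat \<Rightarrow> nat" where
  "lcfs_customer n a b l =
     (if l \<le> 1 then 1
      else Max {i \<in> {2..n}. a i < b l \<and> i \<notin> (\<lambda>k. lcfs_customer n a b k) ` {2..<l}})"

text \<open>
  Outside \<open>{1..n}\<close> the function is the identity, as \<^const>\<open>permutes\<close> requires.
\<close>
definition lcfs :: "nat \<Rightarrow> (nat \<Rightarrow> real) \<Rightarrow> (nat \<Rightarrow> real) \<Rightarrow> nat \<Rightarrow> nat" where
  "lcfs n a b i =
     (if i \<in> {1..n} then inv_into {1..n} (lcfs_customer n a b) i else i)"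

declare lcfs_customer.simps [simp del]

end

(* Exchange argument: suppose that a feasible permutation agrees with LCFS on the first k services,
   and that at the next one it serves i instead of the LCFS choice j > i. Swapping i and j
   preserves feasibility and, as j is served later than i, does not increase the sum, by the
   rearrangement inequality for two terms. Iterating turns every feasible permutation into LCFS. *)

theory Submission
  imports Defs
begin

text \<open>Customer 1 takes service 1, so the customer of any later service lies in
  \<open>{2..n}\<close>, where the arrival constraint is available.\<close>

lemma realizable_inverse_image:
  assumes "\<pi> \<in> realizable n a b" "l \<in> {2..n}"
  obtains i where "i \<in> {2..n}" "\<pi> i = l" "a i < b l"
proof -
  have p: "\<pi> permutes {1..n}" "\<pi> 1 = 1" and f: "\<And>i. i \<in> {2..n} \<Longrightarrow> a i < b (\<pi> i)"
    using assms(1) by (auto simp: realizable_def)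
  have "l \<in> \<pi> ` {1..n}"
    using assms(2) permutes_image[OF p(1)] by auto
  then obtain i where i: "i \<in> {1..n}" "\<pi> i = l"
    by blast
  with p(2) assms(2) have "i \<noteq> 1"
    by auto
  with i have "i \<in> {2..n}"
    by auto
  with i f show thesis
    using that by blast
qed

text \<open>One round of the exchange: agreement with LCFS is extended from the services before
  \<open>l\<close> to \<open>l\<close> itself, at no cost in the sum.\<close>

lemma lcfs_customer_exchange:
  assumes a: "strict_mono_on {1..n} a" and b: "strict_mono_on {1..n} b"
    and \<pi>: "\<pi> \<in> realizable n a b"
    and agree: "\<And>m. m \<in> {1..<l} \<Longrightarrow> \<pi> (lcfs_customer n a b m) = m"
    and l: "l \<in> {2..n}"
  obtains \<pi>' where "\<pi>' \<in> realizable n a b"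
    "assignment_sum n a b \<pi>' \<le> assignment_sum n a b \<pi>"
    "\<And>m. m \<in> {1..l} \<Longrightarrow> \<pi>' (lcfs_customer n a b m) = m"
proof -
  let ?c = "lcfs_customer n a b"
  have p: "\<pi> permutes {1..n}" and p1: "\<pi> 1 = 1"
    and feas: "\<And>i. i \<in> {2..n} \<Longrightarrow> a i < b (\<pi> i)"
    using \<pi> by (auto simp: realizable_def)
  obtain i where i: "i \<in> {2..n}" "\<pi> i = l" "a i < b l"
    using realizable_inverse_image[OF \<pi> l] .
  define S where "S = {i \<in> {2..n}. a i < b l \<and> i \<notin> ?c ` {2..<l}}"
  define j where "j = ?c l"
  \<comment> \<open>By \<open>agree\<close>, \<open>\<pi>\<close> serves the earlier LCFS customers
    before \<open>l\<close>, whereas it serves \<open>i\<close> at \<open>l\<close>. So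
    \<open>i\<close> is itself a candidate for LCFS, which gives \<open>i \<le> j\<close>.\<close>
  have "i \<notin> ?c ` {2..<l}"
  proof
    assume "i \<in> ?c ` {2..<l}"
    then obtain m where "m \<in> {2..<l}" "i = ?c m"
      by blast
    with agree[of m] i(2) show False
      by auto
  qed
  with i have "i \<in> S"
    by (auto simp: S_def)
  moreover have "finite S"
    by (auto simp: S_def)
  moreover have "j = Max S"
    using l by (simp add: j_def S_def lcfs_customer.simps[of n a b l])
  ultimately have "i \<le> j" "j \<in> S"
    by (auto intro: Max_in)
  then have j: "j \<in> {2..n}" "a j < b l" "j \<notin> ?c ` {2..<l}"
    by (auto simp: S_def)
  show thesis
  proof (cases "i = j")
    case True
    have "\<pi> (?c m) = m" if "m \<in> {1..l}" for m
      using that agree[of m] True i(2) by (cases "m = l") (auto simp: j_def)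
    with \<pi> show thesis
      using that[of \<pi>] by simp
  next
    case False
    with \<open>i \<le> j\<close> have ij: "i < j"
      by simp
    have inj: "x = y" if "\<pi> x = \<pi> y" for x y
      using permutes_inj[OF p] that by (auto dest: injD)
    \<comment> \<open>Service \<open>l\<close> is taken by \<open>i\<close> and service 1 by
      customer 1. Any service strictly between would, by \<open>agree\<close> and injectivity, make
      \<open>j\<close> an LCFS customer already served, contrary to its choice.\<close>
    have late: "l < \<pi> j"
    proof (rule ccontr)
      assume "\<not> l < \<pi> j"
      moreover have "\<pi> j \<noteq> l"
        using inj[of i j] i(2) False by auto
      moreover have "\<pi> j \<in> {1..n}"
        using permutes_in_image[OF p, of j] j(1) by simp
      moreover have "\<pi> j \<noteq> 1"
        using inj[of j 1] p1 j(1) by auto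
      ultimately have m: "\<pi> j \<in> {2..<l}"
        by auto
      then have "?c (\<pi> j) = j"
        using agree[of "\<pi> j"] inj by auto
      with m j(3) show False
        by (metis image_eqI)
    qed
    have pj: "\<pi> j \<in> {1..n}"
      using permutes_in_image[OF p, of j] j(1) by simp
    have aij: "a i < a j"
      using strict_mono_onD[OF a, of i j] ij i(1) j(1) by simp
    have blj: "b l < b (\<pi> j)"
      using strict_mono_onD[OF b, of l "\<pi> j"] late l pj by simp
    define \<pi>' where "\<pi>' = \<pi> \<circ> transpose i j"
    have \<pi>'_i: "\<pi>' i = \<pi> j" and \<pi>'_j: "\<pi>' j = l"
      and \<pi>'_other: "\<And>k. k \<noteq> i \<Longrightarrow> k \<noteq> j \<Longrightarrow> \<pi>' k = \<pi> k"
      using i(2) by (auto simp: \<pi>'_def)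
    have "\<pi>' permutes {1..n}"
      unfolding \<pi>'_def
      by (rule permutes_compose[OF permutes_swap_id p]) (use i(1) j(1) in auto)
    moreover have "\<pi>' 1 = 1"
      using \<pi>'_other[of 1] p1 i(1) j(1) by auto
    \<comment> \<open>Only two constraints change: \<open>i\<close> moves to a later service, and
      \<open>j\<close> moves to \<open>b l\<close>, before which it has arrived because LCFS selects
      it there.\<close>
    moreover have "a k < b (\<pi>' k)" if "k \<in> {2..n}" for k
    proof -
      consider "k = i" | "k = j" | "k \<noteq> i" "k \<noteq> j"
        by blast
      then show ?thesis
        by cases (use \<pi>'_i \<pi>'_j \<pi>'_other feas[OF that] i(3) j(2) blj in auto)
    qed
    ultimately have "\<pi>' \<in> realizable n a b"
      by (auto simp: realizable_def)
    moreover have "assignment_sum n a b \<pi>' \<le> assignment_sum n a b \<pi>"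
    proof -
      have split: "(\<Sum>k=1..n. g k) = g i + g j + (\<Sum>k\<in>{1..n} - {i} - {j}. g k)"
        for g :: "nat \<Rightarrow> real"
        using i(1) j(1) False
          sum.remove[of "{1..n}" i g] sum.remove[of "{1..n} - {i}" j g]
        by (simp add: add.assoc)
      have "(\<Sum>k\<in>{1..n} - {i} - {j}. a k * b (\<pi>' k)) =
            (\<Sum>k\<in>{1..n} - {i} - {j}. a k * b (\<pi> k))"
        by (rule sum.cong) (auto simp: \<pi>'_other)
      moreover have "a i * b (\<pi> j) + a j * b l \<le> a i * b l + a j * b (\<pi> j)"
      proof -
        have "0 \<le> (a j - a i) * (b (\<pi> j) - b l)"
          using aij blj by simp
        then show ?thesis
          by (simp add: algebra_simps)
      qed
      ultimately show ?thesis
        unfolding assignment_sum_def split by (simp add: \<pi>'_i \<pi>'_j i(2))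
    qed
    \<comment> \<open>The swapped customers have \<open>\<pi>\<close>-values \<open>l\<close> and
      above, so the agreement below \<open>l\<close> is untouched.\<close>
    moreover have "\<pi>' (?c m) = m" if m: "m \<in> {1..l}" for m
    proof (cases "m = l")
      case True
      then show ?thesis
        using \<pi>'_j by (simp add: j_def)
    next
      case False
      with m have "m < l" and eq: "\<pi> (?c m) = m"
        using agree[of m] by auto
      then have "?c m \<noteq> i" "?c m \<noteq> j"
        using i(2) late by auto
      with eq show ?thesis
        by (simp add: \<pi>'_other)
    qed
    ultimately show thesis
      by (rule that)
  qed
qed

text \<open>Induction on \<open>k\<close>: the base case holds because both sides put customer 1 at
  service 1, and each step is one exchange, the bounds on the sum being chained by
  transitivity.\<close>

lemma lcfs_customer_prefix:
  assumes "strict_mono_on {1..n} a" "strict_mono_on {1..n} b"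
    and \<pi>: "\<pi> \<in> realizable n a b" and "1 \<le> k" "k \<le> n"
  shows "\<exists>\<pi>' \<in> realizable n a b. assignment_sum n a b \<pi>' \<le> assignment_sum n a b \<pi> \<and>
           (\<forall>l\<in>{1..k}. \<pi>' (lcfs_customer n a b l) = l)"
  using \<open>1 \<le> k\<close> \<open>k \<le> n\<close>
proof (induction k rule: dec_induct)
  case base
  have "\<pi> 1 = 1"
    using \<pi> by (simp add: realizable_def)
  with \<pi> show ?case
    by (auto simp: lcfs_customer.simps[of n a b "Suc 0"] intro!: bexI[of _ \<pi>])
next
  case (step k)
  then obtain \<rho> where \<rho>: "\<rho> \<in> realizable n a b"
    "assignment_sum n a b \<rho> \<le> assignment_sum n a b \<pi>"
    "\<And>l. l \<in> {1..<Suc k} \<Longrightarrow> \<rho> (lcfs_customer n a b l) = l"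
    by (auto simp: less_Suc_eq_le)
  have "Suc k \<in> {2..n}"
    using step by simp
  then obtain \<pi>' where "\<pi>' \<in> realizable n a b"
    "assignment_sum n a b \<pi>' \<le> assignment_sum n a b \<rho>"
    "\<And>l. l \<in> {1..Suc k} \<Longrightarrow> \<pi>' (lcfs_customer n a b l) = l"
    using lcfs_customer_exchange[OF assms(1,2) \<rho>(1,3)] by metis
  with \<rho>(2) show ?case
    by (meson order_trans)
qed

text \<open>A left inverse makes \<open>lcfs_customer\<close> injective on \<open>{1..n}\<close>, so
  \<open>inv_into\<close> is determined there; outside that range both functions are the
  identity.\<close>

lemma lcfs_eqI:
  assumes p: "\<pi> permutes {1..n}"
    and inv: "\<And>l. l \<in> {1..n} \<Longrightarrow> \<pi> (lcfs_customer n a b l) = l"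
  shows "lcfs n a b = \<pi>"
proof
  fix i
  show "lcfs n a b i = \<pi> i"
  proof (cases "i \<in> {1..n}")
    case True
    then have pi: "\<pi> i \<in> {1..n}"
      using permutes_in_image[OF p] by blast
    have "inj_on (lcfs_customer n a b) {1..n}"
      using inv by (rule inj_on_inverseI)
    \<comment> \<open>Both sides have the same image under the injective
      \<open>\<pi>\<close>.\<close>
    moreover have "lcfs_customer n a b (\<pi> i) = i"
      using inv[OF pi] permutes_inj[OF p] by (auto dest: injD)
    ultimately have "inv_into {1..n} (lcfs_customer n a b) i = \<pi> i"
      using pi inv_into_f_f by metis
    with True show ?thesis
      by (simp add: lcfs_def)
  next
    case False
    then show ?thesis
      using permutes_not_in[OF p False] by (simp only: lcfs_def if_False)
  qed
qed

theorem mainTheorem2: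
  fixes n :: nat and a b :: "nat \<Rightarrow> real"
  assumes "n \<ge> 1"
    and "strict_mono_on {1..n} a"
    and "strict_mono_on {1..n} b"
    and "a 1 = b 1"
    and "distinct (map a [2..<Suc n] @ map b [2..<Suc n])"
    and "realizable n a b \<noteq> {}"
  shows "lcfs n a b \<in> realizable n a b \<and>
         (\<forall>\<pi> \<in> realizable n a b.
            assignment_sum n a b (lcfs n a b) \<le> assignment_sum n a b \<pi>)"
proof -
  \<comment> \<open>With \<open>k = n\<close> the exchanged permutation is LCFS itself, so any
    \<open>\<pi>\<close> yields both realizability and the bound; nonemptiness then supplies a
    \<open>\<pi>\<close> for the former.\<close>
  have key: "lcfs n a b \<in> realizable n a b \<and>
      assignment_sum n a b (lcfs n a b) \<le> assignment_sum n a b \<pi>"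
    if \<pi>: "\<pi> \<in> realizable n a b" for \<pi>
  proof -
    obtain \<pi>' where \<pi>': "\<pi>' \<in> realizable n a b"
      "assignment_sum n a b \<pi>' \<le> assignment_sum n a b \<pi>"
      "\<And>l. l \<in> {1..n} \<Longrightarrow> \<pi>' (lcfs_customer n a b l) = l"
      using lcfs_customer_prefix[OF assms(2,3) \<pi> assms(1) order_refl] by blast
    then have "lcfs n a b = \<pi>'"
      by (intro lcfs_eqI) (auto simp: realizable_def)
    with \<pi>' show ?thesis
      by simp
  qed
  with assms(6) show ?thesis
    by blast
qed

end
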